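(* The maximum of $\mathcal{C}_1^{(5)}$ over all 5-qubit CSX-states $$|\psi_X^{(5)}\rangle=a|00000\rangle+c\,\overbrace{|00011\rangle}+d\,\overbrace{|00101\rangle}+g\,\overbrace{|01111\rangle},\qquad a,c,d,g\in\mathbb{C},\ |a|^2+|c|^2+|d|^2+|g|^2=1,$$ is approximately $0.468$ (value rounded to three decimal places), and it is attained at a state with $a=g=0$ and real $c\approx 0.298$, $d\approx 0.955$ (rounded to three decimal places).
   Context: For a bit string $i_1\dots i_n$, $\overbrace{|i_1 i_2\dots i_n\rangle}$ denotes the normalized equal-weight superposition of the distinct computational basis vectors obtained from $|i_1\dots i_n\rangle$ by cyclic permutations of the $n$ tensor factors (for each of the three five-bit strings displayed with an overbrace in the claim the orbit has 5 elements and the normalization is $1/\sqrt5$). A CSX-state is a pure state invariant under cyclic permutations of the parties which is a superposition only of computational basis elements containing an even number of 1's; for 5 qubits these are exactly the states displayed in the claim. For a two-qubit density matrix $\rho$, the (Wootters) concurrence is $\mathcal{C}(\rho)=\max\{0,\lambda_1-\lambda_2-\lambda_3-\lambda_4\}$, where $\lambda_1\ge\lambda_2\ge\lambda_3\ge\lambda_4$ are the square roots of the eigenvalues of $\rho\tilde\rho$, with $\tilde\rho=(\sigma_y\otimes\sigma_y)\rho^*(\sigma_y\otimes\sigma_y)$ and $\rho^*$ the entrywise complex conjugate in the computational basis. $\mathcal{C}_1^{(5)}$ of a cyclically symmetric 5-qubit state is the concurrence of the reduced density matrix of two adjacent parties (labels differing by 1 mod 5). "Approximately $x$, rounded to three decimal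 places" means within $0.0005$ of $x$. *)

theory Defs
  imports "Jordan_Normal_Form.Char_Poly"
begin

section \<open>Pure states of n qubits\<close>

text \<open>
  A state of \<open>n\<close> qubits is a complex vector of dimension \<open>2 ^ n\<close>; a bit string names a basis vector
  by its value as a binary numeral, the first party carrying the most significant bit.  Parties are
  labelled \<open>0, \<dots>, n - 1\<close>.
\<close>

definition bitstrings :: "nat \<Rightarrow> nat list set" where
  "bitstrings n = {bs. length bs = n \<and> set bs \<subseteq> {0, 1}}"

definition bits_index :: "nat list \<Rightarrow> nat" where
  "bits_index bs = horner_sum id 2 (rev bs)"

definition ket :: "nat list \<Rightarrow> complex vec" where
  "ket bs = unit_vec (2 ^ length bs) (bits_index bs)"

definition cyclic_orbit :: "nat list \<Rightarrow> nat list set" where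
  "cyclic_orbit bs = range (\<lambda>k. rotate k bs)"

text \<open>The overbrace: the normalised sum of the distinct cyclic shifts of a basis vector.\<close>

definition cyclic_ket :: "nat list \<Rightarrow> complex vec" where
  "cyclic_ket bs = vec (2 ^ length bs)
     (\<lambda>k. (\<Sum>cs \<in> cyclic_orbit bs. ket cs $ k) / complex_of_real (sqrt (card (cyclic_orbit bs))))"

definition cyclic_invariant :: "nat \<Rightarrow> complex vec \<Rightarrow> bool" where
  "cyclic_invariant n \<psi> \<longleftrightarrow>
     (\<forall>bs \<in> bitstrings n. \<forall>k. \<psi> $ bits_index (rotate k bs) = \<psi> $ bits_index bs)"

definition csx_state :: "nat \<Rightarrow> complex vec \<Rightarrow> bool" where
  "csx_state n \<psi> \<longleftrightarrow> \<psi> \<in> carrier_vec (2 ^ n) \<and> \<psi> \<bullet>c \<psi> = 1 \<and> cyclic_invariant n \<psi> \<and>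
     (\<forall>bs \<in> bitstrings n. odd (sum_list bs) \<longrightarrow> \<psi> $ bits_index bs = 0)"

definition psi_X5 :: "complex \<Rightarrow> complex \<Rightarrow> complex \<Rightarrow> complex \<Rightarrow> complex vec" where
  "psi_X5 a c d g =
     a \<cdot>\<^sub>v ket [0,0,0,0,0] + c \<cdot>\<^sub>v cyclic_ket [0,0,0,1,1]
     + d \<cdot>\<^sub>v cyclic_ket [0,0,1,0,1] + g \<cdot>\<^sub>v cyclic_ket [0,1,1,1,1]"


section \<open>Two-party reduced density matrices\<close>

definition pure_density :: "complex vec \<Rightarrow> complex mat" where
  "pure_density \<psi> = mat (dim_vec \<psi>) (dim_vec \<psi>) (\<lambda>(r, s). \<psi> $ r * cnj (\<psi> $ s))"

text \<open>
  The partial trace over all parties except \<open>i \<noteq> j\<close>.  Row and column indices \<open>2 * x + y\<close> of the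
  result stand for bit \<open>x\<close> at party \<open>i\<close> and bit \<open>y\<close> at party \<open>j\<close>; the summation variable \<open>bs\<close> is the
  full row index, and the column index agrees with it at all traced-out parties.
\<close>

definition reduced_density :: "nat \<Rightarrow> complex mat \<Rightarrow> nat \<Rightarrow> nat \<Rightarrow> complex mat" where
  "reduced_density n \<rho> i j = mat 4 4 (\<lambda>(r, s).
     \<Sum>bs \<in> {bs \<in> bitstrings n. 2 * bs ! i + bs ! j = r}.
       \<rho> $$ (bits_index bs, bits_index (bs[i := s div 2, j := s mod 2])))"


section \<open>Wootters concurrence\<close>

definition kronecker :: "complex mat \<Rightarrow> complex mat \<Rightarrow> complex mat" where
  "kronecker A B = mat (dim_row A * dim_row B) (dim_col A * dim_col B)
     (\<lambda>(r, s). A $$ (r div dim_row B, s div dim_col B) * B $$ (r mod dim_row B, s mod dim_col B))"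

definition sigma_y :: "complex mat" where
  "sigma_y = mat_of_rows_list 2 [[0, - \<i>], [\<i>, 0]]"

definition spin_flip :: "complex mat \<Rightarrow> complex mat" where
  "spin_flip \<rho> = kronecker sigma_y sigma_y * map_mat cnj \<rho> * kronecker sigma_y sigma_y"

text \<open>
  The eigenvalues are taken with algebraic multiplicity.  For a density matrix \<open>\<rho>\<close> those of
  \<open>\<rho> * spin_flip \<rho>\<close> are real and nonnegative, so that \<open>Re\<close> loses nothing.
\<close>

definition concurrence_roots :: "complex mat \<Rightarrow> real list" where
  "concurrence_roots \<rho> =
     rev (sorted_list_of_multiset
       (image_mset (\<lambda>z. sqrt (Re z)) (proots (char_poly (\<rho> * spin_flip \<rho>)))))"

definition concurrence :: "complex mat \<Rightarrow> real" where
  "concurrence \<rho> = (let l = concurrence_roots \<rho> in max 0 (l ! 0 - l ! 1 - l ! 2 - l ! 3))"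

definition nn_concurrence :: "nat \<Rightarrow> complex vec \<Rightarrow> real" where
  "nn_concurrence n \<psi> = concurrence (reduced_density n (pure_density \<psi>) 0 1)"


section \<open>Well-definedness\<close>

lemma length_concurrence_roots:
  assumes "\<rho> \<in> carrier_mat 4 4"
  shows "length (concurrence_roots \<rho>) = 4"
proof -
  have "\<rho> * spin_flip \<rho> \<in> carrier_mat 4 4"
    using assms by (auto simp: spin_flip_def kronecker_def sigma_y_def mat_of_rows_list_def)
  from degree_monic_char_poly[OF this] show ?thesis
    by (metis concurrence_roots_def length_rev mset_sorted_list_of_multiset size_image_mset
        size_mset size_proots_complex)
qed

lemma bits_index_less: "bs \<in> bitstrings n \<Longrightarrow> bits_index bs < 2 ^ n"
proof (induction n arbitrary: bs)
  case (Suc n)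
  then obtain b cs where bs: "bs = b # cs" and cs: "cs \<in> bitstrings n" and b: "b \<le> 1"
    by (cases bs) (auto simp: bitstrings_def)
  have "bits_index bs = bits_index cs + 2 ^ n * b"
    using cs by (simp add: bits_index_def bs horner_sum_append bitstrings_def)
  moreover have "2 ^ n * b \<le> 2 ^ n" using b by simp
  ultimately show ?case using Suc.IH[OF cs] unfolding power_Suc by linarith
qed (auto simp: bitstrings_def bits_index_def)

text \<open>For a cyclically invariant state, every pair of adjacent parties has the same reduced state.\<close>

lemma reduced_density_adjacent:
  assumes \<psi>: "\<psi> \<in> carrier_vec (2 ^ n)" "cyclic_invariant n \<psi>" and i: "i < n" and n: "n \<ge> 2"
  shows "reduced_density n (pure_density \<psi>) i ((i + 1) mod n) = reduced_density n (pure_density \<psi>) 0 1"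
proof (rule eq_matI)
  fix r s assume "r < dim_row (reduced_density n (pure_density \<psi>) 0 1)"
    "s < dim_col (reduced_density n (pure_density \<psi>) 0 1)"
  then have rs: "r < 4" "s < 4" by (auto simp: reduced_density_def)
  define j where "j = (i + 1) mod n"
  have j: "j < n" using n by (simp add: j_def)
  have upd: "rotate i (bs[i := x, j := y]) = (rotate i bs)[0 := x, 1 := y]"
    if "length bs = n" for bs :: "nat list" and x y
  proof (rule nth_equalityI)
    fix k assume "k < length (rotate i (bs[i := x, j := y]))"
    then have k: "k < n" using that by simp
    have *: "(i + k) mod n = i \<longleftrightarrow> k = 0"
      using k i by (auto simp: mod_if split: if_splits)
    have **: "(i + k) mod n = j \<longleftrightarrow> k = 1"
      using k i n unfolding j_def by (auto simp: mod_if split: if_splits)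
    have "(i + k) mod n < n" using k by simp
    then show "rotate i (bs[i := x, j := y]) ! k = (rotate i bs)[0 := x, 1 := y] ! k"
      using k that * ** i j by (auto simp: nth_rotate nth_list_update)
  qed simp
  have rho: "pure_density \<psi> $$ (bits_index bs, bits_index cs) =
      pure_density \<psi> $$ (bits_index (rotate i bs), bits_index (rotate i cs))"
    if "bs \<in> bitstrings n" "cs \<in> bitstrings n" for bs cs
  proof -
    have "rotate i bs \<in> bitstrings n" "rotate i cs \<in> bitstrings n"
      using that by (auto simp: bitstrings_def)
    then show ?thesis using that \<psi>
      by (simp add: pure_density_def bits_index_less cyclic_invariant_def)
  qed
  have inv: "rotate i (rotate (n - i) bs) = bs" "rotate (n - i) (rotate i bs) = bs"
    if "length bs = n" for bs :: "nat list"
    using that i by (simp_all add: rotate_rotate rotate_id)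
  have set_upd: "bs[u := x, v := y] \<in> bitstrings n"
    if "bs \<in> bitstrings n" "x \<le> 1" "y \<le> 1" for bs u v x y
    using that unfolding bitstrings_def
    by (auto dest!: subsetD[OF set_update_subset_insert])
  have s: "s div 2 \<le> 1" "s mod 2 \<le> 1" using rs by auto
  have nth: "rotate i bs ! 0 = bs ! i" "rotate i bs ! 1 = bs ! j" if "length bs = n" for bs :: "nat list"
    using that i n by (simp_all add: nth_rotate j_def)
  have "(\<Sum>bs \<in> {bs \<in> bitstrings n. 2 * bs ! i + bs ! j = r}.
       pure_density \<psi> $$ (bits_index bs, bits_index (bs[i := s div 2, j := s mod 2]))) =
     (\<Sum>bs \<in> {bs \<in> bitstrings n. 2 * bs ! 0 + bs ! 1 = r}.
       pure_density \<psi> $$ (bits_index bs, bits_index (bs[0 := s div 2, 1 := s mod 2])))"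
  proof (rule sum.reindex_bij_witness[where i = "rotate (n - i)" and j = "rotate i"])
    fix bs assume "bs \<in> {bs \<in> bitstrings n. 2 * bs ! i + bs ! j = r}"
    then have bs: "bs \<in> bitstrings n" "length bs = n" "2 * bs ! i + bs ! j = r"
      by (auto simp: bitstrings_def)
    show "rotate (n - i) (rotate i bs) = bs" using inv bs by simp
    show "rotate i bs \<in> {bs \<in> bitstrings n. 2 * bs ! 0 + bs ! 1 = r}"
      using bs nth by (auto simp: bitstrings_def)
    show "pure_density \<psi> $$ (bits_index (rotate i bs),
            bits_index ((rotate i bs)[0 := s div 2, 1 := s mod 2])) =
          pure_density \<psi> $$ (bits_index bs, bits_index (bs[i := s div 2, j := s mod 2]))"
      using rho[OF bs(1) set_upd[OF bs(1) s]] upd[OF bs(2)] by simp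
  next
    fix bs assume "bs \<in> {bs \<in> bitstrings n. 2 * bs ! 0 + bs ! 1 = r}"
    then have bs: "bs \<in> bitstrings n" "length bs = n" "2 * bs ! 0 + bs ! 1 = r"
      by (auto simp: bitstrings_def)
    show "rotate i (rotate (n - i) bs) = bs" using inv bs by simp
    show "rotate (n - i) bs \<in> {bs \<in> bitstrings n. 2 * bs ! i + bs ! j = r}"
      using bs nth[of "rotate (n - i) bs"] inv(1)[OF bs(2)] by (auto simp: bitstrings_def)
  qed
  then show "reduced_density n (pure_density \<psi>) i ((i + 1) mod n) $$ (r, s) =
      reduced_density n (pure_density \<psi>) 0 1 $$ (r, s)"
    using rs by (simp add: reduced_density_def j_def)
qed (simp_all add: reduced_density_def)


section \<open>The five-qubit CSX-states\<close>

lemma cyclic_orbit_eq: "bs \<noteq> [] \<Longrightarrow> cyclic_orbit bs = (\<lambda>k. rotate k bs) ` set [0..<length bs]"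
  unfolding cyclic_orbit_def
  by (auto simp: image_iff) (metis rotate_conv_mod atLeastLessThan_iff length_greater_0_conv
      mod_less_divisor zero_le)

lemma Ball_bitstrings_Suc:
  "(\<forall>bs \<in> bitstrings (Suc n). P bs) \<longleftrightarrow> (\<forall>bs \<in> bitstrings n. P (0 # bs) \<and> P (1 # bs))"
proof -
  have "bitstrings (Suc n) = (#) 0 ` bitstrings n \<union> (#) 1 ` bitstrings n"
    by (force simp: bitstrings_def length_Suc_conv image_iff)
  then show ?thesis by auto
qed

lemma cyclic_invariant_iff:
  "cyclic_invariant n \<psi> \<longleftrightarrow> (\<forall>bs \<in> bitstrings n. \<psi> $ bits_index (rotate1 bs) = \<psi> $ bits_index bs)"
proof
  assume *: "\<forall>bs \<in> bitstrings n. \<psi> $ bits_index (rotate1 bs) = \<psi> $ bits_index bs"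
  have "\<psi> $ bits_index (rotate k bs) = \<psi> $ bits_index bs" if "bs \<in> bitstrings n" for bs k
  proof (induction k)
    case (Suc k)
    have "rotate k bs \<in> bitstrings n" using that by (auto simp: bitstrings_def)
    then show ?case using * Suc by simp
  qed simp
  then show "cyclic_invariant n \<psi>" by (simp add: cyclic_invariant_def)
next
  assume "cyclic_invariant n \<psi>"
  then show "\<forall>bs \<in> bitstrings n. \<psi> $ bits_index (rotate1 bs) = \<psi> $ bits_index bs"
    unfolding cyclic_invariant_def by (metis One_nat_def rotate1_rotate_swap rotate_Suc rotate0 id_apply)
qed

lemma cyclic_orbit_5:
  "cyclic_orbit [0,0,0,1,1] = {[0,0,0,1,1],[0,0,1,1,0],[0,1,1,0,0],[1,1,0,0,0],[1,0,0,0,1]}"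
  "cyclic_orbit [0,0,1,0,1] = {[0,0,1,0,1],[0,1,0,1,0],[1,0,1,0,0],[0,1,0,0,1],[1,0,0,1,0]}"
  "cyclic_orbit [0,1,1,1,1] = {[0,1,1,1,1],[1,1,1,1,0],[1,1,1,0,1],[1,1,0,1,1],[1,0,1,1,1]}"
proof -
  have *: "cyclic_orbit [a,b,c,d,e] =
      {[a,b,c,d,e],[b,c,d,e,a],[c,d,e,a,b],[d,e,a,b,c],[e,a,b,c,d]}" for a b c d e
    by (simp add: cyclic_orbit_eq rotate_def upt_rec)
  show "cyclic_orbit [0,0,0,1,1] = {[0,0,0,1,1],[0,0,1,1,0],[0,1,1,0,0],[1,1,0,0,0],[1,0,0,0,1]}"
    "cyclic_orbit [0,0,1,0,1] = {[0,0,1,0,1],[0,1,0,1,0],[1,0,1,0,0],[0,1,0,0,1],[1,0,0,1,0]}"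
    "cyclic_orbit [0,1,1,1,1] = {[0,1,1,1,1],[1,1,1,1,0],[1,1,1,0,1],[1,1,0,1,1],[1,0,1,1,1]}"
    by (simp_all only: *)
qed

lemma cyclic_ket_index:
  assumes "k < 32"
  shows "cyclic_ket [0,0,0,1,1] $ k = (if k \<in> {3,6,12,24,17} then 1 / complex_of_real (sqrt 5) else 0)"
    and "cyclic_ket [0,0,1,0,1] $ k = (if k \<in> {5,10,20,9,18} then 1 / complex_of_real (sqrt 5) else 0)"
    and "cyclic_ket [0,1,1,1,1] $ k = (if k \<in> {15,30,29,27,23} then 1 / complex_of_real (sqrt 5) else 0)"
    and "ket [0,0,0,0,0] $ k = (if k = 0 then 1 else 0)"
  using assms
  by (auto simp: cyclic_ket_def cyclic_orbit_5 cyclic_orbit_5[unfolded One_nat_def] ket_def bits_index_def)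

lemma dim_psi_X5: "psi_X5 a c d g \<in> carrier_vec 32"
  by (auto simp: psi_X5_def ket_def cyclic_ket_def)

lemma psi_X5_index:
  assumes "k < 32"
  shows "psi_X5 a c d g $ k =
    (if k = 0 then a else if k \<in> {3,6,12,24,17} then c / complex_of_real (sqrt 5)
     else if k \<in> {5,10,20,9,18} then d / complex_of_real (sqrt 5)
     else if k \<in> {15,30,29,27,23} then g / complex_of_real (sqrt 5) else 0)"
proof -
  have "dim_vec (ket [0,0,0,0,0]) = 32" "dim_vec (cyclic_ket [0,0,0,1,1]) = 32"
    "dim_vec (cyclic_ket [0,0,1,0,1]) = 32" "dim_vec (cyclic_ket [0,1,1,1,1]) = 32"
    by (simp_all add: ket_def cyclic_ket_def)
  then show ?thesis
    using assms cyclic_ket_index[OF assms] by (auto simp: psi_X5_def)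
qed

lemma upt_32: "[0..<32] = [0,1,2,3,4,5,6,7,8,9,10,11,12,13,14,15,16,17,18,19,20,21,22,23,24,25,26,27,28,29,30,31]"
  by code_simp

lemma csx_state_5_explicit:
  "csx_state 5 \<psi> \<longleftrightarrow> \<psi> \<in> carrier_vec 32 \<and> \<psi> \<bullet>c \<psi> = 1 \<and>
     (\<forall>k \<in> {6,12,24,17}. \<psi> $ k = \<psi> $ 3) \<and> (\<forall>k \<in> {10,20,9,18}. \<psi> $ k = \<psi> $ 5) \<and>
     (\<forall>k \<in> {30,29,27,23}. \<psi> $ k = \<psi> $ 15) \<and>
     (\<forall>k \<in> {1,2,4,8,16,7,14,28,25,19,11,22,13,26,21,31}. \<psi> $ k = 0)"
proof -
  have five: "(5::nat) = Suc (Suc (Suc (Suc (Suc 0))))" by simp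
  have zero: "(\<forall>bs \<in> bitstrings 0. P bs) \<longleftrightarrow> P []" for P by (auto simp: bitstrings_def)
  have par: "(\<forall>bs \<in> bitstrings 5. odd (sum_list bs) \<longrightarrow> \<psi> $ bits_index bs = 0) \<longleftrightarrow>
     (\<forall>k \<in> {1,2,4,8,16,7,14,28,25,19,11,22,13,26,21,31}. \<psi> $ k = 0)"
    unfolding five Ball_bitstrings_Suc zero by (simp add: bits_index_def numeral_2_eq_2[symmetric] del: One_nat_def) argo
  have cyc: "cyclic_invariant 5 \<psi> \<longleftrightarrow>
     (\<forall>k \<in> {6,12,24,17}. \<psi> $ k = \<psi> $ 3) \<and> (\<forall>k \<in> {10,20,9,18}. \<psi> $ k = \<psi> $ 5) \<and>
     (\<forall>k \<in> {30,29,27,23}. \<psi> $ k = \<psi> $ 15) \<and>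
     (\<forall>k \<in> {2,4,8,16}. \<psi> $ k = \<psi> $ 1) \<and> (\<forall>k \<in> {14,28,25,19}. \<psi> $ k = \<psi> $ 7) \<and>
     (\<forall>k \<in> {22,13,26,21}. \<psi> $ k = \<psi> $ 11)"
    unfolding cyclic_invariant_iff five Ball_bitstrings_Suc zero 
    by (simp add: bits_index_def numeral_2_eq_2[symmetric] del: One_nat_def)
      (intro iffI; elim conjE; intro conjI; metis)
  show ?thesis unfolding csx_state_def par cyc by auto
qed

lemma psi_X5_norm:
  "psi_X5 a c d g \<bullet>c psi_X5 a c d g =
    complex_of_real ((cmod a)\<^sup>2 + (cmod c)\<^sup>2 + (cmod d)\<^sup>2 + (cmod g)\<^sup>2)"
proof -
  let ?s = "complex_of_real (sqrt 5)"
  have D: "dim_vec (psi_X5 a c d g) = 32" using dim_psi_X5 by (rule carrier_vecD)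
  have S: "x / ?s * cnj (x / ?s) =
      complex_of_real ((cmod x)\<^sup>2 / 5)" for x
    unfolding complex_norm_square[symmetric] by (simp add: norm_divide power_divide)
  have sum32: "sum f {0..<32} = sum_list (map f [0..<32])" for f :: "nat \<Rightarrow> complex"
    by (simp add: interv_sum_list_conv_sum_set_nat)
  have "psi_X5 a c d g \<bullet>c psi_X5 a c d g =
      (\<Sum>k = 0..<32. psi_X5 a c d g $ k * cnj (psi_X5 a c d g $ k))"
    by (simp add: scalar_prod_def D)
  also have "\<dots> = (\<Sum>k::nat = 0..<32. complex_of_real
      (if k = 0 then (cmod a)\<^sup>2 else if k \<in> {3,6,12,24,17} then (cmod c)\<^sup>2 / 5
       else if k \<in> {5,10,20,9,18} then (cmod d)\<^sup>2 / 5
       else if k \<in> {15,30,29,27,23} then (cmod g)\<^sup>2 / 5 else 0))"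
  proof (rule sum.cong)
    fix k :: nat assume "k \<in> {0..<32}"
    then have k: "k < 32" by simp
    have if_square: "(if P then a else if Q then c / ?s else if R then d / ?s else if T then g / ?s else 0) *
        cnj (if P then a else if Q then c / ?s else if R then d / ?s else if T then g / ?s else 0) =
        complex_of_real (if P then (cmod a)\<^sup>2 else if Q then (cmod c)\<^sup>2 / 5
          else if R then (cmod d)\<^sup>2 / 5 else if T then (cmod g)\<^sup>2 / 5 else 0)" for P Q R T
      by (cases P; cases Q; cases R; cases T)
        (simp_all only: if_True if_False S complex_norm_square mult_zero_left of_real_0)
    show "psi_X5 a c d g $ k * cnj (psi_X5 a c d g $ k) = complex_of_real
      (if k = 0 then (cmod a)\<^sup>2 else if k \<in> {3,6,12,24,17} then (cmod c)\<^sup>2 / 5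
       else if k \<in> {5,10,20,9,18} then (cmod d)\<^sup>2 / 5
       else if k \<in> {15,30,29,27,23} then (cmod g)\<^sup>2 / 5 else 0)"
      unfolding psi_X5_index[OF k] by (rule if_square)
  qed simp
  also have "\<dots> = complex_of_real ((cmod a)\<^sup>2 + (cmod c)\<^sup>2 + (cmod d)\<^sup>2 + (cmod g)\<^sup>2)"
    unfolding sum32 upt_32 by simp
  finally show ?thesis .
qed

theorem csx_state_5_iff:
  "csx_state 5 \<psi> \<longleftrightarrow> (\<exists>a c d g. \<psi> = psi_X5 a c d g \<and>
     (cmod a)\<^sup>2 + (cmod c)\<^sup>2 + (cmod d)\<^sup>2 + (cmod g)\<^sup>2 = 1)"
proof
  assume csx: "csx_state 5 \<psi>"
  let ?s = "complex_of_real (sqrt 5)"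
  note E = csx[unfolded csx_state_5_explicit, simplified]
  have eq: "\<psi> = psi_X5 (\<psi> $ 0) (?s * \<psi> $ 3) (?s * \<psi> $ 5) (?s * \<psi> $ 15)" (is "_ = ?p")
  proof (rule eq_vecI)
    fix k assume "k < dim_vec ?p"
    then have k: "k < 32" using dim_psi_X5 by (metis carrier_vecD)
    then have "k \<in> set [0..<32]" by simp
    moreover have "set [0..<32] \<subseteq>
        {0,3,6,12,24,17,5,10,20,9,18,15,30,29,27,23,1,2,4,8,16,7,14,28,25,19,11,22,13,26,21,31}"
      unfolding upt_32 by simp
    ultimately have "k \<in> {0,3,6,12,24,17,5,10,20,9,18,15,30,29,27,23,1,2,4,8,16,7,14,28,25,19,11,22,13,26,21,31}"
      by (rule rev_subsetD)
    then show "\<psi> $ k = ?p $ k"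
      unfolding psi_X5_index[OF k] by (elim insertE emptyE) (simp_all add: E)
  next
    show "dim_vec \<psi> = dim_vec ?p"
      using carrier_vecD[OF conjunct1[OF csx[unfolded csx_state_5_explicit]]] carrier_vecD[OF dim_psi_X5]
      by (rule trans[OF _ sym])
  qed
  have "\<psi> \<bullet>c \<psi> = 1" using csx unfolding csx_state_def by blast
  then have "?p \<bullet>c ?p = 1" using eq by (rule subst[rotated])
  then have "(cmod (\<psi> $ 0))\<^sup>2 + (cmod (?s * \<psi> $ 3))\<^sup>2 + (cmod (?s * \<psi> $ 5))\<^sup>2 + (cmod (?s * \<psi> $ 15))\<^sup>2 = 1"
    unfolding psi_X5_norm of_real_eq_1_iff .
  with eq show "\<exists>a c d g. \<psi> = psi_X5 a c d g \<and>
     (cmod a)\<^sup>2 + (cmod c)\<^sup>2 + (cmod d)\<^sup>2 + (cmod g)\<^sup>2 = 1" by blast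
next
  assume "\<exists>a c d g. \<psi> = psi_X5 a c d g \<and>
     (cmod a)\<^sup>2 + (cmod c)\<^sup>2 + (cmod d)\<^sup>2 + (cmod g)\<^sup>2 = 1"
  then obtain a c d g where p: "\<psi> = psi_X5 a c d g"
    and norm: "(cmod a)\<^sup>2 + (cmod c)\<^sup>2 + (cmod d)\<^sup>2 + (cmod g)\<^sup>2 = 1" by blast
  show "csx_state 5 \<psi>"
    unfolding csx_state_5_explicit p psi_X5_norm norm by (simp add: dim_psi_X5 psi_X5_index)
qed

end

theory Submission
  imports Defs
begin

text \<open>
  The reduced density matrix of two adjacent parties is X-shaped, so its concurrence is at most
  \<open>2 * max {0, \<bar>w\<bar> - sqrt (p * q), \<bar>z\<bar> - sqrt (r * s)}\<close>, where \<open>z\<close>, \<open>w\<close> are the outer and inner off-diagonal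
  entries and \<open>p, r, s, q\<close> the diagonal.  The outer branch is a quadratic form that is too small to matter.
  In the inner branch, \<open>a\<close> and \<open>g\<close> only do harm and phases may be dropped, which leaves the maximisation of
  \<open>2 * c * d + d\<^sup>2 - c * sqrt (2 * c\<^sup>2 + d\<^sup>2)\<close> on the quarter circle.  There, as a function of \<open>c\<close>, the derivative is
  strictly decreasing and changes sign between 0.2975 and 0.2982.
\<close>

section \<open>X-shaped matrices\<close>

text \<open>Indices 0, 3 and 1, 2 decouple, so Laplace expansion collapses to a product of two 2x2
  minors. Stated over a commutative ring because it is applied to the characteristic matrix, whose
  entries are polynomials.\<close>

lemma det_4_x_shaped:
  fixes A :: "'a :: comm_ring_1 mat"
  assumes A: "A \<in> carrier_mat 4 4"
    and zero: "\<And>i j. i < 4 \<Longrightarrow> j < 4 \<Longrightarrow> j \<noteq> i \<Longrightarrow> i + j \<noteq> 3 \<Longrightarrow> A $$ (i, j) = 0"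
  shows "det A = (A $$ (0,0) * A $$ (3,3) - A $$ (0,3) * A $$ (3,0)) *
    (A $$ (1,1) * A $$ (2,2) - A $$ (1,2) * A $$ (2,1))"
proof -
  have d2: "det B = B $$ (0,0) * B $$ (1,1) - B $$ (0,1) * B $$ (1,0)"
    if B: "B \<in> carrier_mat 2 2" for B :: "'a mat"
    using B by (subst laplace_expansion_row[OF B, of 0])
      (auto simp: numeral_2_eq_2 cofactor_def det_single mat_delete_def)
  have d3: "det B = B $$ (0,0) * (B $$ (1,1) * B $$ (2,2) - B $$ (1,2) * B $$ (2,1))
      - B $$ (0,1) * (B $$ (1,0) * B $$ (2,2) - B $$ (1,2) * B $$ (2,0))
      + B $$ (0,2) * (B $$ (1,0) * B $$ (2,1) - B $$ (1,1) * B $$ (2,0))"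
    if B: "B \<in> carrier_mat 3 3" for B :: "'a mat"
    using B by (subst laplace_expansion_row[OF B, of 0])
      (auto simp: numeral_3_eq_3 numeral_2_eq_2 cofactor_def d2[unfolded numeral_2_eq_2] mat_delete_def
        algebra_simps)
  have sum4: "sum h {..<4::nat} = h 0 + h 1 + h 2 + h 3" for h :: "nat \<Rightarrow> 'a"
    by (simp add: eval_nat_numeral add_ac)
  have md: "mat_delete A i j $$ (k, l) = A $$ (if k < i then k else k + 1, if l < j then l else l + 1)"
    if "k < 3" "l < 3" for i j k l
    using A that by (simp add: mat_delete_def)
  have d: "mat_delete A i j \<in> carrier_mat 3 3" for i j
    using mat_delete_carrier[OF A, of i j] by simp
  then have c: "cofactor A i j = (-1) ^ (i + j) * det (mat_delete A i j)" for i j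
    by (simp add: cofactor_def)
  show ?thesis
    unfolding laplace_expansion_row[OF A, of 0, simplified] sum4
    by (simp add: c d3[OF d] md zero, simp add: numeral_2_eq_2 numeral_3_eq_3 algebra_simps)
qed


section \<open>X-shaped matrices under the spin flip\<close>

text \<open>In the basis 00, 01, 10, 11 the diagonal reads \<open>p, r, s, q\<close>. The arguments
  are grouped by block: \<open>p, q, z\<close> belong to the outer one, \<open>r, s, w\<close> to
  the inner one.\<close>

definition x_mat :: "real \<Rightarrow> real \<Rightarrow> real \<Rightarrow> real \<Rightarrow> complex \<Rightarrow> complex \<Rightarrow> complex mat" where
  "x_mat p q r s z w = mat_of_rows_list 4
     [[of_real p, 0, 0, z], [0, of_real r, w, 0], [0, cnj w, of_real s, 0], [cnj z, 0, 0, of_real q]]"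

text \<open>Ranging over explicit index sets lets the simplifier evaluate all 16 entries one by
  one.\<close>

lemma eq_mat_4I:
  assumes "A \<in> carrier_mat 4 4" "B \<in> carrier_mat 4 4"
    and "\<And>i. i \<in> {0,1,2,3} \<Longrightarrow> \<forall>j \<in> {0,1,2,3}. A $$ (i, j) = B $$ (i, j)"
  shows "A = B"
proof (rule eq_matI)
  fix i j assume "i < dim_row B" "j < dim_col B"
  then have "i \<in> {0,1,2,3}" "j \<in> {0,1,2,3}" using assms(2) by auto
  then show "A $$ (i, j) = B $$ (i, j)" using assms(3) by blast
qed (use assms in auto)

lemma mat_of_rows_list_4_carrier [simp]: "length rs = 4 \<Longrightarrow> mat_of_rows_list 4 rs \<in> carrier_mat 4 4"
  by (simp add: mat_of_rows_list_def)

lemma mat_of_rows_list_4_index: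
  "i < length rs \<Longrightarrow> j < 4 \<Longrightarrow> mat_of_rows_list 4 rs $$ (i, j) = rs ! i ! j"
  by (simp add: mat_of_rows_list_def)

lemma mult_mat_4:
  fixes A B :: "'a :: comm_semiring_1 mat"
  assumes "A \<in> carrier_mat 4 4" "B \<in> carrier_mat 4 4" "i < 4" "j < 4"
  shows "(A * B) $$ (i, j) = A $$ (i, 0) * B $$ (0, j) + A $$ (i, 1) * B $$ (1, j)
    + A $$ (i, 2) * B $$ (2, j) + A $$ (i, 3) * B $$ (3, j)"
  using assms by (simp add: scalar_prod_def eval_nat_numeral add_ac)

lemma sigma_y_kronecker:
  "kronecker sigma_y sigma_y = mat_of_rows_list 4 [[0,0,0,-1],[0,0,1,0],[0,1,0,0],[-1,0,0,0]]"
proof -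
  have S: "dim_row sigma_y = 2" "dim_col sigma_y = 2" "sigma_y $$ (0, 0) = 0" "sigma_y $$ (0, Suc 0) = - \<i>"
    "sigma_y $$ (Suc 0, 0) = \<i>" "sigma_y $$ (Suc 0, Suc 0) = 0"
    by (simp_all add: sigma_y_def mat_of_rows_list_def)
  show ?thesis
    by (rule eq_mat_4I) (auto simp: kronecker_def S mat_of_rows_list_4_index)
qed

lemma x_mat_carrier [simp]: "x_mat p q r s z w \<in> carrier_mat 4 4"
  by (simp add: x_mat_def)

text \<open>Conjugation by the antidiagonal matrix reverses the basis, which swaps the diagonal
  entries within each block. On the antidiagonal the reversal undoes the complex conjugation and the
  signs cancel, so \<open>z\<close> and \<open>w\<close> survive.\<close>

lemma spin_flip_x_mat: "spin_flip (x_mat p q r s z w) = x_mat q p s r z w"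
proof -
  define Y where "Y = mat_of_rows_list 4 [[0,0,0,-1],[0,0,1,0],[0,1,0,0],[-1,0,0,0::complex]]"
  define X where "X = map_mat cnj (x_mat p q r s z w)"
  have C: "Y \<in> carrier_mat 4 4" "X \<in> carrier_mat 4 4" "Y * X \<in> carrier_mat 4 4"
    by (simp_all add: X_def Y_def mult_carrier_mat[where n = 4])
  have X: "X = mat_of_rows_list 4
     [[of_real p, 0, 0, cnj z], [0, of_real r, cnj w, 0], [0, w, of_real s, 0], [z, 0, 0, of_real q]]"
    by (rule eq_mat_4I) (auto simp: X_def x_mat_def mat_of_rows_list_def)
  have "Y * X = mat_of_rows_list 4
     [[- z, 0, 0, - of_real q], [0, w, of_real s, 0], [0, of_real r, cnj w, 0], [- of_real p, 0, 0, - cnj z]]"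
    by (rule eq_mat_4I) (auto simp: C mult_mat_4, auto simp: X Y_def mat_of_rows_list_4_index)
  then have "Y * X * Y = x_mat q p s r z w"
    by (intro eq_mat_4I) (auto simp: C mult_mat_4 x_mat_def mult_carrier_mat[where n = 4],
      auto simp: Y_def mat_of_rows_list_4_index)
  then show ?thesis
    by (simp add: spin_flip_def sigma_y_kronecker X_def Y_def)
qed
text \<open>The product is again X-shaped, and each 2x2 block has equal diagonal entries, so its
  eigenvalues are perfect squares. The form as linear factors lets the roots be read off.\<close>

lemma char_poly_x_mat_mult:
  fixes z w :: complex
  assumes "p \<ge> 0" "q \<ge> 0" "r \<ge> 0" "s \<ge> 0"
  defines "N \<equiv> x_mat p q r s z w * spin_flip (x_mat p q r s z w)"
  shows "char_poly N = [:- of_real ((sqrt (p * q) + cmod z)\<^sup>2), 1:] * [:- of_real ((sqrt (p * q) - cmod z)\<^sup>2), 1:]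
    * ([:- of_real ((sqrt (r * s) + cmod w)\<^sup>2), 1:] * [:- of_real ((sqrt (r * s) - cmod w)\<^sup>2), 1:])"
proof -
  \<comment> \<open>One identity serves both blocks: with \<open>m = sqrt (x * y)\<close> and
    \<open>n = cmod u\<close>, the left side is (X - (m^2 + n^2))^2 - (2mn)^2, a difference of
    squares.\<close>
  have factor: "[:- (of_real x * of_real y + u * cnj u), 1:] * [:- (of_real x * of_real y + u * cnj u), 1:]
      - [:- (2 * of_real x * u):] * [:- (2 * of_real y * cnj u):]
    = [:- complex_of_real ((sqrt (x * y) + cmod u)\<^sup>2), 1:] * [:- of_real ((sqrt (x * y) - cmod u)\<^sup>2), 1:]"
    if "x \<ge> 0" "y \<ge> 0" for x y u
  proof -
    define m where "m = complex_of_real (sqrt (x * y))"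
    define n where "n = complex_of_real (cmod u)"
    have "m * m = complex_of_real (x * y)" using that
      by (simp only: m_def of_real_mult[symmetric]) simp
    then have m: "of_real x * of_real y = m * m" by simp
    have n: "u * cnj u = n * n" using complex_norm_square[of u] by (simp add: n_def power2_eq_square)
    have e: "complex_of_real ((sqrt (x * y) + cmod u)\<^sup>2) = (m + n) * (m + n)"
      "complex_of_real ((sqrt (x * y) - cmod u)\<^sup>2) = (m - n) * (m - n)"
      by (simp_all add: m_def n_def power2_eq_square)
    have "(2 * of_real x * u) * (2 * of_real y * cnj u) = 4 * (m * m) * (n * n)"
      unfolding m[symmetric] n[symmetric] by (simp add: algebra_simps)
    then show ?thesis unfolding e m n by (simp add: algebra_simps)
  qed
  have N: "N \<in> carrier_mat 4 4" by (simp add: N_def spin_flip_x_mat mult_carrier_mat[where n = 4])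
  have entry: "char_poly_matrix N $$ (i, j) = (if i = j then [:- N $$ (i, j), 1:] else [:- N $$ (i, j):])"
    if "i < 4" "j < 4" for i j
    using N that by (auto simp: char_poly_matrix_def)
  define L where "L = mat_of_rows_list 4
     [[of_real p * of_real q + z * cnj z, 0, 0, 2 * of_real p * z],
      [0, of_real r * of_real s + w * cnj w, 2 * of_real r * w, 0],
      [0, 2 * of_real s * cnj w, of_real r * of_real s + w * cnj w, 0],
      [2 * of_real q * cnj z, 0, 0, of_real p * of_real q + z * cnj z]]"
  have NL: "N = L"
    unfolding N_def spin_flip_x_mat L_def
    by (rule eq_mat_4I)
      (auto simp: mult_mat_4 mult_carrier_mat[where n = 4],
        auto simp: x_mat_def mat_of_rows_list_4_index algebra_simps)
  have idx: "\<forall>i \<in> {0,1,2,3}. \<forall>j \<in> {0,1,2,3}. j \<noteq> i \<longrightarrow> i + j \<noteq> 3 \<longrightarrow> L $$ (i, j) = 0"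
    by (simp add: L_def mat_of_rows_list_4_index)
  have "det (char_poly_matrix N) =
     ([:- (of_real p * of_real q + z * cnj z), 1:] * [:- (of_real p * of_real q + z * cnj z), 1:]
      - [:- (2 * of_real p * z):] * [:- (2 * of_real q * cnj z):]) *
     ([:- (of_real r * of_real s + w * cnj w), 1:] * [:- (of_real r * of_real s + w * cnj w), 1:]
      - [:- (2 * of_real r * w):] * [:- (2 * of_real s * cnj w):])"
  proof (subst det_4_x_shaped)
    fix i j :: nat assume *: "i < 4" "j < 4" "j \<noteq> i" "i + j \<noteq> 3"
    then have "i \<in> {0,1,2,3}" "j \<in> {0,1,2,3}" by auto
    then have "N $$ (i, j) = 0" using idx * NL by blast
    then show "char_poly_matrix N $$ (i, j) = 0" using * by (simp add: entry)
  qed (use N in \<open>simp_all add: entry\<close>, simp add: NL L_def mat_of_rows_list_4_index algebra_simps)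
  then show ?thesis unfolding char_poly_def factor[OF assms(1,2)] factor[OF assms(3,4)] .
qed

section \<open>Concurrence of X-shaped matrices\<close>

text \<open>Which root is largest depends on the parameters, so the roots are given only as a
  multiset.\<close>

lemma concurrence_roots_x_mat:
  assumes "p \<ge> 0" "q \<ge> 0" "r \<ge> 0" "s \<ge> 0"
  shows "mset (concurrence_roots (x_mat p q r s z w)) =
    {#sqrt (p * q) + cmod z, \<bar>sqrt (p * q) - cmod z\<bar>, sqrt (r * s) + cmod w, \<bar>sqrt (r * s) - cmod w\<bar>#}"
  using assms unfolding concurrence_roots_def char_poly_x_mat_mult[OF assms]
  by (simp add: proots_mult del: mult_pCons_left mult_pCons_right)

text \<open>This rewrites the largest root minus the other three as twice the largest minus the sum,
  so that only the multiset of roots matters.\<close>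

lemma concurrence_eq:
  assumes "\<rho> \<in> carrier_mat 4 4"
  shows "concurrence \<rho> = max 0 (2 * Max (set (concurrence_roots \<rho>)) - sum_list (concurrence_roots \<rho>))"
proof -
  let ?l = "concurrence_roots \<rho>"
  have len: "length ?l = 4" by (rule length_concurrence_roots[OF assms])
  have "sorted (rev ?l)" by (simp add: concurrence_roots_def)
  then have "Max (set ?l) = ?l ! 0"
    using len by (intro Max_eqI) (auto simp: in_set_conv_nth[of _ ?l] intro: sorted_rev_nth_mono, force)
  moreover have "sum_list ?l = ?l ! 0 + ?l ! 1 + ?l ! 2 + ?l ! 3"
    using len by (simp add: sum_list_sum_nth eval_nat_numeral add_ac)
  ultimately show ?thesis by (simp add: concurrence_def Let_def)
qed

lemma concurrence_x_mat:
  assumes "p \<ge> 0" "q \<ge> 0" "r \<ge> 0" "s \<ge> 0"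
  shows "concurrence (x_mat p q r s z w) = max 0 (2 * max (sqrt (p * q) + cmod z) (sqrt (r * s) + cmod w)
    - 2 * max (sqrt (p * q)) (cmod z) - 2 * max (sqrt (r * s)) (cmod w))"
proof -
  let ?l = "concurrence_roots (x_mat p q r s z w)"
  note m = concurrence_roots_x_mat[OF assms, of z w]
  have "set ?l = {sqrt (p * q) + cmod z, \<bar>sqrt (p * q) - cmod z\<bar>, sqrt (r * s) + cmod w, \<bar>sqrt (r * s) - cmod w\<bar>}"
    using arg_cong[OF m, of set_mset] by simp
  moreover have nn: "sqrt (p * q) \<ge> 0" "sqrt (r * s) \<ge> 0" "cmod z \<ge> 0" "cmod w \<ge> 0" using assms by simp_all
  moreover have "\<bar>sqrt (p * q) - cmod z\<bar> \<le> sqrt (p * q) + cmod z" "\<bar>sqrt (r * s) - cmod w\<bar> \<le> sqrt (r * s) + cmod w"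
    using nn by linarith+
  ultimately have "Max (set ?l) = max (sqrt (p * q) + cmod z) (sqrt (r * s) + cmod w)"
    by (intro Max_eqI) (auto simp: le_max_iff_disj max_def)
  \<comment> \<open>Each block contributes m + n + \<bar>m - n\<bar>, which is twice the maximum of
    m and n.\<close>
  moreover have "sum_list ?l = 2 * max (sqrt (p * q)) (cmod z) + 2 * max (sqrt (r * s)) (cmod w)"
    unfolding sum_mset_sum_list[symmetric] m by (auto simp: max_def)
  ultimately show ?thesis by (simp add: concurrence_eq algebra_simps)
qed

text \<open>If the outer block holds the largest root, the difference is twice min (sqrt (p * q))
  (cmod z) minus twice max (sqrt (r * s)) (cmod w), hence at most
  \<open>2 * (cmod z - sqrt (r * s))\<close>. The other case is symmetric.\<close>

lemma concurrence_x_mat_le: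
  assumes "p \<ge> 0" "q \<ge> 0" "r \<ge> 0" "s \<ge> 0"
    and "B \<ge> 0" "2 * (cmod z - sqrt (r * s)) \<le> B" "2 * (cmod w - sqrt (p * q)) \<le> B"
  shows "concurrence (x_mat p q r s z w) \<le> B"
  using assms(5-) by (auto simp: concurrence_x_mat[OF assms(1-4)] max_def)

text \<open>The last two hypotheses are positivity of the two blocks; they turn the subtracted
  maxima into \<open>sqrt (p * q)\<close> and \<open>sqrt (r * s)\<close>.\<close>

lemma concurrence_x_mat_ge:
  assumes "p \<ge> 0" "q \<ge> 0" "r \<ge> 0" "s \<ge> 0"
    and "cmod z \<le> sqrt (p * q)" "cmod w \<le> sqrt (r * s)"
  shows "2 * (cmod w - sqrt (p * q)) \<le> concurrence (x_mat p q r s z w)"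
  using assms(5-) by (auto simp: concurrence_x_mat[OF assms(1-4)] max_def)

section \<open>The reduced state of two adjacent parties\<close>

lemma finite_bitstrings: "finite (bitstrings n)"
  unfolding bitstrings_def by (rule finite_subset[OF _ finite_lists_length_eq[of "{0,1}" n]]) auto

lemma sum_bitstrings_0: "sum f (bitstrings 0) = f []"
proof -
  have "bitstrings 0 = {[]}" by (auto simp: bitstrings_def)
  then show ?thesis by simp
qed

lemma sum_bitstrings_Suc: "sum f (bitstrings (Suc n)) = (\<Sum>bs \<in> bitstrings n. f (0 # bs) + f (1 # bs))"
proof -
  have "bitstrings (Suc n) = (#) 0 ` bitstrings n \<union> (#) 1 ` bitstrings n"
    by (force simp: bitstrings_def length_Suc_conv image_iff)
  then have "sum f (bitstrings (Suc n)) = sum f ((#) 0 ` bitstrings n) + sum f ((#) 1 ` bitstrings n)"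
    by (auto intro!: sum.union_disjoint simp: finite_bitstrings)
  then show ?thesis by (simp add: sum.reindex sum.distrib)
qed

text \<open>Parties 0 and 1 carry the leading bits, so a row index determines those bits and the sum
  runs over the remaining, traced-out string.\<close>

lemma reduced_density_first_two:
  assumes \<psi>: "dim_vec \<psi> = 2 ^ (n + 2)" and rs: "r < 4" "s < 4"
  shows "reduced_density (n + 2) (pure_density \<psi>) 0 1 $$ (r, s) =
    (\<Sum>bs \<in> bitstrings n. \<psi> $ bits_index (r div 2 # r mod 2 # bs) * cnj (\<psi> $ bits_index (s div 2 # s mod 2 # bs)))"
proof -
  have bit: "r div 2 \<le> 1" "s div 2 \<le> 1" using rs by auto
  have "{bs \<in> bitstrings (n + 2). 2 * bs ! 0 + bs ! 1 = r} = (\<lambda>bs. r div 2 # r mod 2 # bs) ` bitstrings n" (is "?L = ?R")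
  proof
    show "?L \<subseteq> ?R"
    proof
      fix bs assume bs: "bs \<in> ?L"
      then obtain x y cs where "bs = x # y # cs"
        by (auto simp: bitstrings_def length_Suc_conv)
      with bs show "bs \<in> ?R" by (auto simp: bitstrings_def)
    qed
    show "?R \<subseteq> ?L" using bit by (auto simp: bitstrings_def)
  qed
  moreover have "pure_density \<psi> $$ (bits_index (r div 2 # r mod 2 # bs), bits_index (s div 2 # s mod 2 # bs))
    = \<psi> $ bits_index (r div 2 # r mod 2 # bs) * cnj (\<psi> $ bits_index (s div 2 # s mod 2 # bs))"
    if "bs \<in> bitstrings n" for bs
  proof -
    have "r div 2 # r mod 2 # bs \<in> bitstrings (n + 2)" "s div 2 # s mod 2 # bs \<in> bitstrings (n + 2)"
      using that bit by (auto simp: bitstrings_def)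
    from this[THEN bits_index_less] show ?thesis using \<psi> by (simp add: pure_density_def)
  qed
  ultimately show ?thesis
    using rs by (simp add: reduced_density_def sum.reindex inj_on_def)
qed

text \<open>Nonzero amplitudes have an even number of 1's, so two pairs of leading bits share a
  traced-out string only if their parities agree; this forces the X shape. The coefficients count
  the three-bit completions.\<close>

lemma reduced_density_psi_X5:
  "reduced_density 5 (pure_density (psi_X5 a c d g)) 0 1 = x_mat
     ((5 * (cmod a)\<^sup>2 + 2 * (cmod c)\<^sup>2 + (cmod d)\<^sup>2) / 5) (((cmod c)\<^sup>2 + 3 * (cmod g)\<^sup>2) / 5)
     (((cmod c)\<^sup>2 + 2 * (cmod d)\<^sup>2 + (cmod g)\<^sup>2) / 5) (((cmod c)\<^sup>2 + 2 * (cmod d)\<^sup>2 + (cmod g)\<^sup>2) / 5)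
     ((of_real (sqrt 5) * a * cnj c + 2 * c * cnj g + d * cnj g) / 5)
     ((c * cnj d + d * cnj c + d * cnj d + g * cnj g) / 5)" (is "?R = ?X")
proof -
  define h where "h = complex_of_real (sqrt 5)"
  have h: "h * h = 5" "cnj h = h" "h \<noteq> 0" by (simp_all add: h_def flip: of_real_mult)
  then have h2: "h * (h * x) = 5 * x" for x by (simp flip: mult.assoc)
  \<comment> \<open>Amplitudes per basis vector, with the normalisation \<open>1 / sqrt 5\<close>
    absorbed, make all entries polynomial.\<close>
  define u v y where "u = c / h" and "v = d / h" and "y = g / h"
  have cdg: "c = h * u" "d = h * v" "g = h * y" by (simp_all add: u_def v_def y_def h)
  define w where "w = u * cnj v + v * cnj u + v * cnj v + y * cnj y"
  define r where "r = u * cnj u + 2 * v * cnj v + y * cnj y"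
  define L where "L = mat_of_rows_list 4
    [[a * cnj a + 2 * u * cnj u + v * cnj v, 0, 0, a * cnj u + 2 * u * cnj y + v * cnj y],
     [0, r, w, 0], [0, w, r, 0],
     [cnj a * u + 2 * cnj u * y + cnj v * y, 0, 0, u * cnj u + 3 * y * cnj y]]"
  have X: "?X = L"
    unfolding x_mat_def L_def r_def w_def h_def[symmetric]
    by (simp add: complex_norm_square cdg h h2 algebra_simps flip: of_real_power)
      (simp add: add_divide_distrib algebra_simps)
  have psi: "psi_X5 a c d g $ k = (if k = 0 then a else if k \<in> {3,6,12,24,17} then u
      else if k \<in> {5,10,20,9,18} then v else if k \<in> {15,30,29,27,23} then y else 0)" if "k < 32" for k
    unfolding psi_X5_index[OF that] u_def v_def y_def h_def by (rule refl)
  show ?thesis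
    unfolding X
  proof (rule eq_mat_4I)
    fix i :: nat assume i: "i \<in> {0,1,2,3}"
    show "\<forall>j\<in>{0,1,2,3}. ?R $$ (i, j) = L $$ (i, j)"
    proof
      fix j :: nat assume j: "j \<in> {0,1,2,3}"
      have "i < 4" "j < 4" using i j by auto
      then have R: "?R $$ (i, j) = (\<Sum>bs \<in> bitstrings (Suc (Suc (Suc 0))).
          psi_X5 a c d g $ bits_index (i div 2 # i mod 2 # bs) * cnj (psi_X5 a c d g $ bits_index (j div 2 # j mod 2 # bs)))"
        using reduced_density_first_two[of "psi_X5 a c d g" 3 i j] carrier_vecD[OF dim_psi_X5]
        by (simp flip: numeral_3_eq_3)
      show "?R $$ (i, j) = L $$ (i, j)"
        using i j unfolding R sum_bitstrings_Suc sum_bitstrings_0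
        by (elim insertE emptyE) (simp_all add: bits_index_def psi L_def mat_of_rows_list_4_index r_def w_def)
    qed
  qed (simp_all add: reduced_density_def L_def)
qed

section \<open>Optimisation\<close>

text \<open>This is 5 * (\<bar>w\<bar> - sqrt (p * q)) for \<open>a = g = 0\<close> and nonnegative
  real \<open>c\<close>, \<open>d\<close>; the concurrence it yields is 2/5 of it.\<close>

definition inner_form :: "real \<Rightarrow> real \<Rightarrow> real" where
  "inner_form c d = 2 * c * d + d\<^sup>2 - c * sqrt (2 * c\<^sup>2 + d\<^sup>2)"

text \<open>Homogeneity of degree 2 reduces the maximisation to the unit circle.\<close>

lemma inner_form_scale: "r \<ge> 0 \<Longrightarrow> inner_form (r * c) (r * d) = r\<^sup>2 * inner_form c d"
proof -
  assume r: "r \<ge> 0"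
  have "2 * (r * c)\<^sup>2 + (r * d)\<^sup>2 = r\<^sup>2 * (2 * c\<^sup>2 + d\<^sup>2)"
    by (simp add: algebra_simps power_mult_distrib)
  then have "sqrt (2 * (r * c)\<^sup>2 + (r * d)\<^sup>2) = r * sqrt (2 * c\<^sup>2 + d\<^sup>2)"
    using r by (simp add: real_sqrt_mult)
  then show ?thesis
    by (simp add: inner_form_def algebra_simps power2_eq_square)
qed

lemma inner_form_circle:
  "c\<^sup>2 \<le> 1 \<Longrightarrow> inner_form c (sqrt (1 - c\<^sup>2)) = 2 * c * sqrt (1 - c\<^sup>2) + 1 - c\<^sup>2 - c * sqrt (1 + c\<^sup>2)"
  by (simp add: inner_form_def)

text \<open>The terms are arranged as values of the increasing map 2x - 1/x at
  \<open>sqrt (1 - c\<^sup>2)\<close> and, with a minus sign, at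
  \<open>sqrt (1 + c\<^sup>2)\<close>. The first root decreases and the second increases with
  \<open>c\<close>, so the derivative is visibly decreasing.\<close>

lemma inner_form_circle_deriv:
  assumes "0 \<le> c" "c < 1"
  shows "((\<lambda>c. 2 * c * sqrt (1 - c\<^sup>2) + 1 - c\<^sup>2 - c * sqrt (1 + c\<^sup>2)) has_real_derivative
    2 * (2 * sqrt (1 - c\<^sup>2) - 1 / sqrt (1 - c\<^sup>2)) - 2 * c
      - (2 * sqrt (1 + c\<^sup>2) - 1 / sqrt (1 + c\<^sup>2))) (at c)"
proof -
  have c: "c\<^sup>2 < 1" using assms by (simp add: abs_square_less_1)
  define s where "s = sqrt (1 - c\<^sup>2)"
  define t where "t = sqrt (1 + c\<^sup>2)"
  have s: "s > 0" "c\<^sup>2 = 1 - s\<^sup>2" using c by (auto simp: s_def)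
  have t: "t > 0" "c\<^sup>2 = t\<^sup>2 - 1" by (auto simp: t_def add_pos_nonneg)
  have "1 + c\<^sup>2 > 0" by (simp add: add_pos_nonneg)
  then have "((\<lambda>c. 2 * c * sqrt (1 - c\<^sup>2) + 1 - c\<^sup>2 - c * sqrt (1 + c\<^sup>2)) has_real_derivative
      2 * s - 2 * (c\<^sup>2 / s) - 2 * c - (t + c\<^sup>2 / t)) (at c)"
    using c s(1) t(1) unfolding s_def t_def
    by (auto intro!: derivative_eq_intros simp: field_simps power2_eq_square)
  moreover have "c\<^sup>2 / s = 1 / s - s"
    unfolding s(2) using s(1) by (simp add: field_simps power2_eq_square)
  moreover have "c\<^sup>2 / t = t - 1 / t"
    unfolding t(2) using t(1) by (simp add: field_simps power2_eq_square)
  ultimately show ?thesis unfolding s_def[symmetric] t_def[symmetric]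
    by (simp add: algebra_simps)
qed

lemma double_minus_inverse_mono: "0 < x \<Longrightarrow> x \<le> y \<Longrightarrow> 2 * x - 1 / x \<le> 2 * y - 1 / (y::real)"
  using frac_le[of 1 1 x y] by simp

text \<open>A maximiser exists by compactness. It is an interior critical point, and monotonicity of
  the derivative confines it to a short interval.\<close>

lemma inner_form_max:
  obtains c d :: real where "c \<ge> 0" "d \<ge> 0" "c\<^sup>2 + d\<^sup>2 = 1" "c \<in> {0.2975..0.2985}" "d \<in> {0.9545..0.9555}"
    "inner_form c d \<in> {1.169..1.17125}"
    "\<And>x y. x \<ge> 0 \<Longrightarrow> y \<ge> 0 \<Longrightarrow> inner_form x y \<le> inner_form c d * (x\<^sup>2 + y\<^sup>2)"
proof -
  define f where "f = (\<lambda>c::real. 2 * c * sqrt (1 - c\<^sup>2) + 1 - c\<^sup>2 - c * sqrt (1 + c\<^sup>2))"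
  have "continuous_on {0..1} f"
    unfolding f_def by (intro continuous_intros)
  then obtain c where c01: "c \<in> {0..1}" and max: "\<And>x. x \<in> {0..1} \<Longrightarrow> f x \<le> f c"
    using continuous_attains_sup[of "{0..1::real}" f] by auto
  define s where "s = sqrt (1 - c\<^sup>2)"
  define t where "t = sqrt (1 + c\<^sup>2)"
  \<comment> \<open>The trial point 0.298 beats both endpoints, so the maximum is interior.\<close>
  have "sqrt (1 - 0.298\<^sup>2) \<ge> 0.95456" "sqrt (1 + 0.298\<^sup>2) \<le> 1.04346"
    by (rule real_le_rsqrt real_le_lsqrt; simp add: power2_eq_square)+
  then have "f 0.298 \<ge> 1.169"
    by (simp add: f_def power2_eq_square field_simps)
  with max[of "0.298"] have lower: "f c \<ge> 1.169" by simp
  moreover have "f 0 = 1" "f 1 \<le> 0" by (simp_all add: f_def)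
  ultimately have c: "0 < c" "c < 1" using c01 by (auto simp: less_le)
  have "2 * (2 * s - 1 / s) - 2 * c - (2 * t - 1 / t) = 0"
  \<comment> \<open>The radius keeps the neighbourhood inside the unit interval, where
    \<open>c\<close> is maximal.\<close>
  proof (rule DERIV_local_max[where f = f and x = c and d = "min c (1 - c)"])
    show "(f has_real_derivative 2 * (2 * s - 1 / s) - 2 * c - (2 * t - 1 / t)) (at c)"
      using inner_form_circle_deriv[of c] c unfolding f_def s_def t_def by simp
    show "\<forall>y. \<bar>c - y\<bar> < min c (1 - c) \<longrightarrow> f y \<le> f c"
      by (auto intro!: max simp: abs_less_iff)
  qed (use c in auto)
  then have crit: "2 * (2 * s - 1 / s) - 2 * c - (2 * t - 1 / t) = 0" .
  have c2: "c\<^sup>2 < 1" using c by (simp add: abs_square_less_1)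
  have s0: "s > 0" using c2 by (simp add: s_def)
  have t0: "t > 0" by (simp add: t_def add_pos_nonneg)
  \<comment> \<open>Below 0.2975 the bounds on \<open>s\<close> and \<open>t\<close> make the
    derivative positive, contradicting \<open>crit\<close>.\<close>
  have cl: "c \<ge> 0.2975"
  proof (rule ccontr)
    assume "\<not> c \<ge> 0.2975"
    then have *: "c < 0.2975" by simp
    then have "c\<^sup>2 \<le> 0.2975\<^sup>2" using c by (intro power_mono) auto
    then have "s \<ge> 0.95472" "t \<le> 1.04332" unfolding s_def t_def
      by - (rule real_le_rsqrt real_le_lsqrt; simp add: power2_eq_square)+
    then show False
      using double_minus_inverse_mono[of "0.95472" s] double_minus_inverse_mono[of t "1.04332"] crit * t0
      by simp
  qed
  \<comment> \<open>Above 0.2982 the derivative is negative. The cut is tighter than the 0.2985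
    needed for \<open>c\<close>, because \<open>sqrt (1 - 0.2985\<^sup>2)\<close> lies below the
    0.9545 required of \<open>d\<close>.\<close>
  have cu: "c \<le> 0.2982"
  proof (rule ccontr)
    assume "\<not> c \<le> 0.2982"
    then have *: "c > 0.2982" by simp
    then have "c\<^sup>2 \<ge> 0.2982\<^sup>2" using c by (intro power_mono) auto
    then have "s \<le> 0.95451" "t \<ge> 1.0435" unfolding s_def t_def
      by - (rule real_le_rsqrt real_le_lsqrt; simp add: power2_eq_square)+
    then show False
      using double_minus_inverse_mono[of s "0.95451"] double_minus_inverse_mono[of "1.0435" t] crit * s0
      by simp
  qed
  have cc: "c\<^sup>2 \<ge> 0.2975\<^sup>2" "c\<^sup>2 \<le> 0.2982\<^sup>2" using cl cu c by (auto intro!: power_mono)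
  then have s: "s \<ge> 0.9545" "s \<le> 0.9548" unfolding s_def
    by - (rule real_le_rsqrt real_le_lsqrt; simp add: power2_eq_square)+
  have fs: "inner_form x (sqrt (1 - x\<^sup>2)) = f x" if "x\<^sup>2 \<le> 1" for x
    using inner_form_circle[OF that] by (simp add: f_def)
  have fc: "inner_form c s = f c" using fs[of c] c2 by (simp add: s_def)
  have "t \<ge> 1.0433" unfolding t_def using cc
    by - (rule real_le_rsqrt; simp add: power2_eq_square)
  then have "c * t \<ge> 0.2975 * 1.0433" using cl by (intro mult_mono) auto
  moreover have "c * s \<le> 0.2982 * 0.9548" using cu s s0 by (intro mult_mono) auto
  ultimately have upper: "f c \<le> 1.17125"
    using cc unfolding f_def s_def[symmetric] t_def[symmetric] by (simp add: power2_eq_square)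
  \<comment> \<open>Any nonzero point of the quadrant is scaled to the circle; the origin is
    trivial.\<close>
  have bound: "inner_form x y \<le> inner_form c s * (x\<^sup>2 + y\<^sup>2)" if xy: "x \<ge> 0" "y \<ge> 0" for x y
  proof (cases "x = 0 \<and> y = 0")
    case False
    define r where "r = sqrt (x\<^sup>2 + y\<^sup>2)"
    have r2: "r\<^sup>2 = x\<^sup>2 + y\<^sup>2" by (simp add: r_def)
    have r: "r > 0" using False by (auto simp: r_def sum_power2_gt_zero_iff)
    have "x \<le> r" by (simp add: r_def real_le_rsqrt)
    then have xr: "x / r \<in> {0..1}" using xy r by simp
    have "1 - (x / r)\<^sup>2 = (y / r)\<^sup>2"
      using r r2 unfolding power_divide
      by (metis add_diff_cancel_left' diff_divide_distrib divide_self_if less_numeral_extra(3) zero_less_power)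
    then have yr: "sqrt (1 - (x / r)\<^sup>2) = y / r" "(x / r)\<^sup>2 \<le> 1"
      using xy r by (simp_all, metis diff_ge_0_iff_ge zero_le_power2 power_divide)
    have "inner_form x y = r\<^sup>2 * inner_form (x / r) (y / r)"
      using inner_form_scale[of r "x / r" "y / r"] r by simp
    also have "\<dots> = r\<^sup>2 * f (x / r)" using fs[OF yr(2)] yr(1) by simp
    also have "\<dots> \<le> r\<^sup>2 * f c" using max[OF xr] by (intro mult_left_mono) auto
    finally show ?thesis by (simp add: fc r2 mult.commute)
  qed (simp add: inner_form_def)
  show thesis
  proof
    show "c\<^sup>2 + s\<^sup>2 = 1" using c2 by (simp add: s_def)
  qed (use c s s0 cl cu fc upper lower bound in auto)
qed

section \<open>Bounds for the two branches\<close>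

text \<open>Every product is split by a completed square until each coefficient falls below
  1.169.\<close>

lemma outer_branch_bound:
  fixes a c d g K :: real
  assumes "K \<ge> 1.169"
  shows "sqrt 5 * a * c + 2 * c * g + d * g - (c\<^sup>2 + 2 * d\<^sup>2 + g\<^sup>2) \<le> K * (a\<^sup>2 + c\<^sup>2 + d\<^sup>2 + g\<^sup>2)"
proof -
  \<comment> \<open>The factor 11/5 is a rational stand-in for \<open>sqrt 5\<close>; it splits the
    first product with the weights 25/22 and 11/10.\<close>
  have "0 \<le> (sqrt 5 * a - 11 / 5 * c)\<^sup>2" "0 \<le> (c - g)\<^sup>2" "0 \<le> (d - g)\<^sup>2" by simp_all
  then have "sqrt 5 * a * c \<le> 25 / 22 * a\<^sup>2 + 11 / 10 * c\<^sup>2"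
      "2 * c * g \<le> c\<^sup>2 + g\<^sup>2" "d * g \<le> 1 / 2 * d\<^sup>2 + 1 / 2 * g\<^sup>2"
    by (simp_all add: power2_diff power_mult_distrib power_divide field_simps)
  moreover have "1169 / 1000 * (a\<^sup>2 + c\<^sup>2 + d\<^sup>2 + g\<^sup>2) \<le> K * (a\<^sup>2 + c\<^sup>2 + d\<^sup>2 + g\<^sup>2)"
    using assms by (intro mult_right_mono) auto
  moreover have "0 \<le> a\<^sup>2" "0 \<le> c\<^sup>2" "0 \<le> d\<^sup>2" "0 \<le> g\<^sup>2" by simp_all
  ultimately show ?thesis unfolding distrib_left by linarith
qed

text \<open>Setting \<open>a\<close> and \<open>g\<close> to zero under the root only shrinks what
  is subtracted, and the leftover \<open>g\<^sup>2\<close> is paid for by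
  \<open>K \<ge> 1\<close>.\<close>

lemma inner_branch_bound:
  fixes a c d g K :: real
  assumes "K \<ge> 1" "g \<ge> 0"
    and "inner_form c d \<le> K * (c\<^sup>2 + d\<^sup>2)" "c \<ge> 0" "d \<ge> 0"
  shows "2 * c * d + d\<^sup>2 + g\<^sup>2 - sqrt ((5 * a\<^sup>2 + 2 * c\<^sup>2 + d\<^sup>2) * (c\<^sup>2 + 3 * g\<^sup>2))
    \<le> K * (a\<^sup>2 + c\<^sup>2 + d\<^sup>2 + g\<^sup>2)"
proof -
  have "c * sqrt (2 * c\<^sup>2 + d\<^sup>2) = sqrt ((2 * c\<^sup>2 + d\<^sup>2) * c\<^sup>2)"
    using assms by (simp add: real_sqrt_mult)
  also have "\<dots> \<le> sqrt ((5 * a\<^sup>2 + 2 * c\<^sup>2 + d\<^sup>2) * (c\<^sup>2 + 3 * g\<^sup>2))"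
    by (intro real_sqrt_le_mono mult_mono) auto
  finally have "2 * c * d + d\<^sup>2 + g\<^sup>2 - sqrt ((5 * a\<^sup>2 + 2 * c\<^sup>2 + d\<^sup>2) * (c\<^sup>2 + 3 * g\<^sup>2))
      \<le> inner_form c d + g\<^sup>2" by (simp add: inner_form_def)
  moreover have "1 * g\<^sup>2 \<le> K * (a\<^sup>2 + g\<^sup>2)"
    using assms by (intro mult_mono) auto
  ultimately show ?thesis using assms by (simp add: algebra_simps)
qed

lemma sqrt_divide_25: "sqrt (x / 25) = sqrt x / 5"
  using real_sqrt_unique[of 5 25] by (simp add: real_sqrt_divide)

text \<open>The right side is the value for nonnegative real amplitudes, so passing to moduli loses
  nothing in an upper bound.\<close>

lemma cmod_inner_le: "cmod (c * cnj d + d * cnj c + d * cnj d + g * cnj g)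
    \<le> 2 * cmod c * cmod d + (cmod d)\<^sup>2 + (cmod g)\<^sup>2"
  using norm_triangle_ineq[of "c * cnj d + d * cnj c + d * cnj d" "g * cnj g"]
    norm_triangle_ineq[of "c * cnj d + d * cnj c" "d * cnj d"] norm_triangle_ineq[of "c * cnj d" "d * cnj c"]
  by (simp add: norm_mult power2_eq_square)

lemma cmod_outer_le: "cmod (complex_of_real (sqrt 5) * a * cnj c + 2 * c * cnj g + d * cnj g)
    \<le> sqrt 5 * cmod a * cmod c + 2 * cmod c * cmod g + cmod d * cmod g"
  using norm_triangle_ineq[of "of_real (sqrt 5) * a * cnj c + 2 * c * cnj g" "d * cnj g"]
    norm_triangle_ineq[of "of_real (sqrt 5) * a * cnj c" "2 * c * cnj g"]
  by (simp add: norm_mult)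

section \<open>The maximum over the CSX-states\<close>

text \<open>Both branches are bounded in terms of the moduli. In 2/5, the 2 comes from the
  concurrence and the 5 from the common denominator of the matrix entries.\<close>

lemma nn_concurrence_psi_X5_le:
  assumes K: "K \<ge> 1.169" "\<And>x y. x \<ge> 0 \<Longrightarrow> y \<ge> 0 \<Longrightarrow> inner_form x y \<le> K * (x\<^sup>2 + y\<^sup>2)"
    and norm: "(cmod a)\<^sup>2 + (cmod c)\<^sup>2 + (cmod d)\<^sup>2 + (cmod g)\<^sup>2 = 1"
  shows "nn_concurrence 5 (psi_X5 a c d g) \<le> 2 / 5 * K"
  unfolding nn_concurrence_def reduced_density_psi_X5
proof (rule concurrence_x_mat_le)
  have root: "sqrt (x / 5 * (y / 5)) = sqrt (x * y) / 5" for x y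
    by (simp add: sqrt_divide_25)
  have "2 * cmod c * cmod d + (cmod d)\<^sup>2 + (cmod g)\<^sup>2
      - sqrt ((5 * (cmod a)\<^sup>2 + 2 * (cmod c)\<^sup>2 + (cmod d)\<^sup>2) * ((cmod c)\<^sup>2 + 3 * (cmod g)\<^sup>2)) \<le> K"
    using inner_branch_bound[of K "cmod g" "cmod c" "cmod d" "cmod a"] K norm by simp
  then show "2 * (cmod ((c * cnj d + d * cnj c + d * cnj d + g * cnj g) / 5) -
      sqrt ((5 * (cmod a)\<^sup>2 + 2 * (cmod c)\<^sup>2 + (cmod d)\<^sup>2) / 5 * (((cmod c)\<^sup>2 + 3 * (cmod g)\<^sup>2) / 5))) \<le> 2 / 5 * K"
    using cmod_inner_le[of c d g] unfolding root norm_divide by simp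
  have "sqrt 5 * cmod a * cmod c + 2 * cmod c * cmod g + cmod d * cmod g
      - ((cmod c)\<^sup>2 + 2 * (cmod d)\<^sup>2 + (cmod g)\<^sup>2) \<le> K"
    using outer_branch_bound[OF K(1), of "cmod a" "cmod c" "cmod g" "cmod d"] norm by simp
  then show "2 * (cmod ((of_real (sqrt 5) * a * cnj c + 2 * c * cnj g + d * cnj g) / 5) -
      sqrt (((cmod c)\<^sup>2 + 2 * (cmod d)\<^sup>2 + (cmod g)\<^sup>2) / 5 * (((cmod c)\<^sup>2 + 2 * (cmod d)\<^sup>2 + (cmod g)\<^sup>2) / 5))) \<le> 2 / 5 * K"
    using cmod_outer_le[of a c g d] unfolding root norm_divide by (simp add: add_divide_distrib)
qed (use K in simp_all)

lemma nn_concurrence_psi_X5_real_ge: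
  assumes "c \<ge> 0" "d \<ge> 0"
  shows "2 / 5 * inner_form c d \<le> nn_concurrence 5 (psi_X5 0 (complex_of_real c) (complex_of_real d) 0)"
proof -
  have "sqrt ((2 * c\<^sup>2 + d\<^sup>2) / 5 * (c\<^sup>2 / 5)) = c * sqrt (2 * c\<^sup>2 + d\<^sup>2) / 5"
    using assms by (simp add: sqrt_divide_25 real_sqrt_mult)
  moreover have "complex_of_real c * cnj (complex_of_real d) + complex_of_real d * cnj (complex_of_real c)
      + complex_of_real d * cnj (complex_of_real d) + 0 * cnj 0 = complex_of_real (2 * c * d + d\<^sup>2)"
    by (simp add: power2_eq_square)
  then have w: "cmod ((complex_of_real c * cnj (complex_of_real d) + complex_of_real d * cnj (complex_of_real c)
      + complex_of_real d * cnj (complex_of_real d) + 0 * cnj 0) / 5) = (2 * c * d + d\<^sup>2) / 5"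
    using assms by (simp only: norm_divide norm_of_real) simp
  \<comment> \<open>Positivity of the inner block; the outer one is trivial since \<open>z\<close>
    vanishes.\<close>
  moreover have "2 * c * d + d\<^sup>2 \<le> c\<^sup>2 + 2 * d\<^sup>2"
    using zero_le_power2[of "c - d"] by (simp add: power2_diff)
  ultimately show ?thesis
    using assms unfolding nn_concurrence_def reduced_density_psi_X5
    by (intro order.trans[OF _ concurrence_x_mat_ge]) (simp_all only: w, simp_all add: inner_form_def sqrt_divide_25 real_sqrt_mult)
qed

theorem mainTheorem4:
  shows "{\<psi>. csx_state 5 \<psi>} =
      {psi_X5 a c d g | a c d g. (cmod a)\<^sup>2 + (cmod c)\<^sup>2 + (cmod d)\<^sup>2 + (cmod g)\<^sup>2 = 1} \<and>
    (\<exists>M c d :: real.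
      (\<forall>\<psi>. csx_state 5 \<psi> \<longrightarrow> nn_concurrence 5 \<psi> \<le> M) \<and>
      csx_state 5 (psi_X5 0 (complex_of_real c) (complex_of_real d) 0) \<and>
      nn_concurrence 5 (psi_X5 0 (complex_of_real c) (complex_of_real d) 0) = M \<and>
      \<bar>M - 0.468\<bar> \<le> 0.0005 \<and> \<bar>c - 0.298\<bar> \<le> 0.0005 \<and> \<bar>d - 0.955\<bar> \<le> 0.0005)"
proof
  show "{\<psi>. csx_state 5 \<psi>} =
      {psi_X5 a c d g | a c d g. (cmod a)\<^sup>2 + (cmod c)\<^sup>2 + (cmod d)\<^sup>2 + (cmod g)\<^sup>2 = 1}"
    using csx_state_5_iff by auto
  obtain c d :: real where cd: "c \<ge> 0" "d \<ge> 0" "c\<^sup>2 + d\<^sup>2 = 1"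
    and loc: "c \<in> {0.2975..0.2985}" "d \<in> {0.9545..0.9555}" "inner_form c d \<in> {1.169..1.17125}"
    and max: "\<And>x y. x \<ge> 0 \<Longrightarrow> y \<ge> 0 \<Longrightarrow> inner_form x y \<le> inner_form c d * (x\<^sup>2 + y\<^sup>2)"
    by (rule inner_form_max) blast
  define M where "M = 2 / 5 * inner_form c d"
  let ?\<psi> = "psi_X5 0 (complex_of_real c) (complex_of_real d) 0"
  have bound: "nn_concurrence 5 \<psi> \<le> M" if "csx_state 5 \<psi>" for \<psi>
    using that nn_concurrence_psi_X5_le[OF _ max] loc unfolding csx_state_5_iff M_def by auto
  have csx: "csx_state 5 ?\<psi>"
    unfolding csx_state_5_iff using cd by (intro exI conjI) (rule refl, simp)
  \<comment> \<open>The general upper bound, applied to the candidate itself, meets the lower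
    bound.\<close>
  have "nn_concurrence 5 ?\<psi> = M"
    using bound[OF csx] nn_concurrence_psi_X5_real_ge[OF cd(1,2)] by (simp add: M_def)
  \<comment> \<open>Scaling 1.169 and 1.17125 by 2/5 gives 0.4676 and 0.4685.\<close>
  moreover have "\<bar>M - 0.468\<bar> \<le> 0.0005" "\<bar>c - 0.298\<bar> \<le> 0.0005" "\<bar>d - 0.955\<bar> \<le> 0.0005"
    using loc unfolding abs_le_iff M_def by auto
  ultimately show "\<exists>M c d :: real.
      (\<forall>\<psi>. csx_state 5 \<psi> \<longrightarrow> nn_concurrence 5 \<psi> \<le> M) \<and>
      csx_state 5 (psi_X5 0 (complex_of_real c) (complex_of_real d) 0) \<and>
      nn_concurrence 5 (psi_X5 0 (complex_of_real c) (complex_of_real d) 0) = M \<and>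
      \<bar>M - 0.468\<bar> \<le> 0.0005 \<and> \<bar>c - 0.298\<bar> \<le> 0.0005 \<and> \<bar>d - 0.955\<bar> \<le> 0.0005"
    using bound csx by blast
qed

end
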